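(* Let $X$ be a weakly orderable quasi-king space. Then every cover of $X$ by clopen subsets of $X$ has a finite subcover.
   Context: All spaces are Hausdorff topological spaces. For a set $X$, let $\mathscr{F}_2(X)=\{S\subset X: 1\le |S|\le 2\}$. A weak selection for $X$ is a map $\sigma:\mathscr{F}_2(X)\to X$ with $\sigma(S)\in S$ for every $S\in\mathscr{F}_2(X)$. It generates the (total, antisymmetric, not necessarily transitive) relation $x\leq_\sigma y$ iff $\sigma(\{x,y\})=x$; write $x<_\sigma y$ if $x\leq_\sigma y$ and $x\neq y$. The selection topology $\mathscr{T}_\sigma$ on $X$ is the topology with subbase consisting of all sets $\{y\in X: y<_\sigma x\}$ and $\{y\in X: x<_\sigma y\}$, $x\in X$. A weak selection $\sigma$ for a space $(X,\mathscr{T})$ is separately continuous if $\mathscr{T}_\sigma\subset\mathscr{T}$. A point $q\in X$ is a quasi $\sigma$-king if for each $x\in X$ there are finitely many points $y_1,\dots,y_n\in X$ with $x\leq_\sigma y_1\leq_\sigma\dots\leq_\sigma y_n\leq_\sigma q$. A space $X$ is quasi-king if it has a separately continuous weak selection, and every separately continuous weak selection $\sigma$ for $X$ has a quasi $\sigma$-king. A space $(X,\mathscr{T})$ is weakly orderable if there is a linear order $\leq$ on $X$ whose open interval topology $\mathscr{T}_\leq$ satisfies $\mathscr{T}_\leq\subset\mathscr{T}$. *)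

theory Defs
  imports "HOL-Analysis.Analysis"
begin

definition F2 :: "'a set \<Rightarrow> 'a set set" where
  "F2 A = {S. S \<subseteq> A \<and> 1 \<le> card S \<and> card S \<le> 2}"

text \<open>Only the values of \<open>\<sigma>\<close> on \<open>F2 A\<close> matter.\<close>

definition weak_selection :: "'a set \<Rightarrow> ('a set \<Rightarrow> 'a) \<Rightarrow> bool" where
  "weak_selection A \<sigma> \<longleftrightarrow> (\<forall>S\<in>F2 A. \<sigma> S \<in> S)"

definition sel_le :: "('a set \<Rightarrow> 'a) \<Rightarrow> 'a \<Rightarrow> 'a \<Rightarrow> bool" where
  "sel_le \<sigma> x y \<longleftrightarrow> \<sigma> {x, y} = x"

definition sel_less :: "('a set \<Rightarrow> 'a) \<Rightarrow> 'a \<Rightarrow> 'a \<Rightarrow> bool" where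
  "sel_less \<sigma> x y \<longleftrightarrow> sel_le \<sigma> x y \<and> x \<noteq> y"

text \<open>
  The topology on \<open>A\<close> whose subbase consists of the open rays of the relation \<open>lt\<close>. As usual,
  the empty intersection of subbasic sets is the whole space, so \<open>A\<close> is inserted explicitly;
  this matters because \<^const>\<open>topology_generated_by\<close> takes the union of the generating
  sets as its carrier, and the rays need not cover \<open>A\<close> (for example when \<open>A\<close> is a singleton).
  For a linear order this is the open interval topology: bounded open intervals
  are intersections of two rays.
\<close>

definition open_ray_topology :: "'a set \<Rightarrow> ('a \<Rightarrow> 'a \<Rightarrow> bool) \<Rightarrow> 'a topology" where
  "open_ray_topology A lt = topology_generated_by
     (insert A ((\<lambda>x. {y \<in> A. lt y x}) ` A \<union> (\<lambda>x. {y \<in> A. lt x y}) ` A))"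

definition selection_topology :: "'a set \<Rightarrow> ('a set \<Rightarrow> 'a) \<Rightarrow> 'a topology" where
  "selection_topology A \<sigma> = open_ray_topology A (sel_less \<sigma>)"

definition order_interval_topology :: "'a set \<Rightarrow> 'a rel \<Rightarrow> 'a topology" where
  "order_interval_topology A r = open_ray_topology A (\<lambda>x y. (x, y) \<in> r \<and> x \<noteq> y)"

definition separately_continuous_selection :: "'a topology \<Rightarrow> ('a set \<Rightarrow> 'a) \<Rightarrow> bool" where
  "separately_continuous_selection X \<sigma> \<longleftrightarrow>
     weak_selection (topspace X) \<sigma> \<and>
     (\<forall>U. openin (selection_topology (topspace X) \<sigma>) U \<longrightarrow> openin X U)"

definition quasi_king_point :: "'a set \<Rightarrow> ('a set \<Rightarrow> 'a) \<Rightarrow> 'a \<Rightarrow> bool" where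
  "quasi_king_point A \<sigma> q \<longleftrightarrow> q \<in> A \<and>
     (\<forall>x\<in>A. \<exists>ys. ys \<noteq> [] \<and> set ys \<subseteq> A \<and> successively (sel_le \<sigma>) (x # ys @ [q]))"

definition quasi_king_space :: "'a topology \<Rightarrow> bool" where
  "quasi_king_space X \<longleftrightarrow>
     (\<exists>\<sigma>. separately_continuous_selection X \<sigma>) \<and>
     (\<forall>\<sigma>. separately_continuous_selection X \<sigma> \<longrightarrow>
       (\<exists>q. quasi_king_point (topspace X) \<sigma> q))"

definition weakly_orderable :: "'a topology \<Rightarrow> bool" where
  "weakly_orderable X \<longleftrightarrow>
     (\<exists>r. linear_order_on (topspace X) r \<and>
       (\<forall>U. openin (order_interval_topology (topspace X) r) U \<longrightarrow> openin X U))"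

end

theory Submission
  imports Defs
begin

text \<open>
  The proof plays one fixed linear order on \<open>X\<close> against its rearrangements. A linear order whose
  open rays are open in \<open>X\<close> induces a separately continuous weak selection (take the smaller
  point), and by transitivity a quasi king of this selection is simply a greatest element. So in
  a quasi-king space every such order has a greatest element
  (\<open>quasi_king_space_has_greatest\<close>).

  If \<open>Z\<close> is clopen, an admissible order stays admissible when \<open>Z\<close> is moved behind its complement
  (\<open>open_rays_order_move_last\<close>). If \<open>Z\<close> is nonempty, the greatest element of the new order lies in
  \<open>Z\<close>. Hence every nonempty clopen set has a greatest element in the original order, and, reversing
  that order first, a least one.

  This is a completeness property that replaces the suprema and infima used in the usual proof that
  a closed interval is compact. Let \<open>A\<close> be the set of points below which finitely many
  members of the cover suffice. Just as in that proof, one looks at the cut between \<open>A\<close> and its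
  complement \<open>B\<close>. The topology of \<open>X\<close> may be much finer than the order topology, so a member of the
  cover around a point need not contain an interval around it. But the part of the ray below the
  point that it leaves uncovered is clopen, and so is what any finite subfamily leaves uncovered in
  \<open>X\<close>. These sets have end points, and the end points let one step across the cut
  (\<open>clopen_cover_finite_subcover\<close>).
\<close>

section \<open>Linear orders with open rays\<close>

text \<open>
  Working with the rays themselves avoids the generated topology and makes the symmetry
  under reversal of the order evident.
\<close>

definition open_rays_order :: "'a topology \<Rightarrow> 'a rel \<Rightarrow> bool" where
  "open_rays_order X r \<longleftrightarrow> linear_order_on (topspace X) r \<and>
     (\<forall>x\<in>topspace X. openin X {y \<in> topspace X. (y, x) \<in> r \<and> y \<noteq> x} \<and>
                     openin X {y \<in> topspace X. (x, y) \<in> r \<and> x \<noteq> y})"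

lemma open_ray_topology_coarser_iff:
  "(\<forall>U. openin (open_ray_topology (topspace X) lt) U \<longrightarrow> openin X U) \<longleftrightarrow>
   (\<forall>x\<in>topspace X. openin X {y \<in> topspace X. lt y x} \<and> openin X {y \<in> topspace X. lt x y})"
  (is "?L \<longleftrightarrow> ?R")
proof
  assume L: ?L
  show ?R
    by (intro ballI conjI; rule L[rule_format, unfolded open_ray_topology_def];
        rule topology_generated_by_Basis; blast)
next
  assume R: ?R
  show ?L
  proof (intro allI impI)
    fix U
    assume "openin (open_ray_topology (topspace X) lt) U"
    then have "generate_topology_on (insert (topspace X)
        ((\<lambda>x. {y \<in> topspace X. lt y x}) ` topspace X \<union>
         (\<lambda>x. {y \<in> topspace X. lt x y}) ` topspace X)) U"
      by (simp add: open_ray_topology_def openin_topology_generated_by_iff)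
    then show "openin X U"
      by induction (use R in auto)
  qed
qed

lemma weakly_orderable_iff_open_rays_order:
  "weakly_orderable X \<longleftrightarrow> (\<exists>r. open_rays_order X r)"
  by (simp add: weakly_orderable_def open_rays_order_def order_interval_topology_def
      open_ray_topology_coarser_iff)

lemma open_rays_order_converse:
  assumes "open_rays_order X r"
  shows "open_rays_order X (r\<inverse>)"
proof -
  have "{y \<in> topspace X. P y \<and> y \<noteq> x} = {y \<in> topspace X. P y \<and> x \<noteq> y}" for P x
    by blast
  then show ?thesis
    using assms unfolding open_rays_order_def by simp
qed

lemma
  assumes "open_rays_order X r"
  shows open_rays_order_refl: "x \<in> topspace X \<Longrightarrow> (x, x) \<in> r"
    and open_rays_order_total:
      "x \<in> topspace X \<Longrightarrow> y \<in> topspace X \<Longrightarrow> (x, y) \<in> r \<or> (y, x) \<in> r"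
    and open_rays_order_antisym: "(x, y) \<in> r \<Longrightarrow> (y, x) \<in> r \<Longrightarrow> x = y"
    and open_rays_order_trans: "(x, y) \<in> r \<Longrightarrow> (y, z) \<in> r \<Longrightarrow> (x, z) \<in> r"
    and open_rays_order_in_space: "(x, y) \<in> r \<Longrightarrow> x \<in> topspace X \<and> y \<in> topspace X"
    and open_rays_order_openin_below:
      "x \<in> topspace X \<Longrightarrow> openin X {y \<in> topspace X. (y, x) \<in> r \<and> y \<noteq> x}"
    and open_rays_order_openin_above:
      "x \<in> topspace X \<Longrightarrow> openin X {y \<in> topspace X. (x, y) \<in> r \<and> x \<noteq> y}"
proof -
  have "linear_order_on (topspace X) r"
    using assms by (simp add: open_rays_order_def)
  then have sub: "r \<subseteq> topspace X \<times> topspace X" and refl: "refl_on (topspace X) r"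
    and trans: "trans r" and antisym: "antisym r" and total: "total_on (topspace X) r"
    by (auto simp: linear_order_on_def partial_order_on_def preorder_on_def)
  show "x \<in> topspace X \<Longrightarrow> (x, x) \<in> r"
    using refl by (rule refl_onD)
  show "x \<in> topspace X \<Longrightarrow> y \<in> topspace X \<Longrightarrow> (x, y) \<in> r \<or> (y, x) \<in> r"
    using refl total by (cases "x = y") (auto simp: total_on_def dest: refl_onD)
  show "(x, y) \<in> r \<Longrightarrow> (y, x) \<in> r \<Longrightarrow> x = y"
    using antisym by (rule antisymD)
  show "(x, y) \<in> r \<Longrightarrow> (y, z) \<in> r \<Longrightarrow> (x, z) \<in> r"
    using trans by (rule transD)
  show "(x, y) \<in> r \<Longrightarrow> x \<in> topspace X \<and> y \<in> topspace X"
    using sub by blast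
qed (use assms in \<open>simp_all add: open_rays_order_def\<close>)

lemma open_rays_order_closedin_atMost:
  assumes "open_rays_order X r" "x \<in> topspace X"
  shows "closedin X {y \<in> topspace X. (y, x) \<in> r}"
proof -
  have "topspace X - {y \<in> topspace X. (y, x) \<in> r} = {y \<in> topspace X. (x, y) \<in> r \<and> x \<noteq> y}"
    using open_rays_order_refl[OF assms(1)] open_rays_order_total[OF assms(1)]
      open_rays_order_antisym[OF assms(1)] assms(2) by blast
  then show ?thesis
    using open_rays_order_openin_above[OF assms] by (auto simp: closedin_def)
qed

section \<open>End points of clopen sets\<close>

text \<open>
  The selection picks the smaller point of each pair. A chain leading from \<open>x\<close> to a quasi king then
  collapses to one inequality.
\<close>

lemma quasi_king_space_has_greatest:
  assumes qk: "quasi_king_space X" and r: "open_rays_order X r"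
  shows "\<exists>q\<in>topspace X. \<forall>x\<in>topspace X. (x, q) \<in> r"
proof -
  define \<sigma> where "\<sigma> = (\<lambda>S. THE x. x \<in> S \<and> (\<forall>y\<in>S. (x, y) \<in> r))"
  note refl = open_rays_order_refl[OF r] and total = open_rays_order_total[OF r]
    and antisym = open_rays_order_antisym[OF r] and trans = open_rays_order_trans[OF r]
  have min_pair: "\<sigma> {x, y} = x" if "(x, y) \<in> r" for x y
    unfolding \<sigma>_def
    by (rule the_equality)
      (use that antisym refl open_rays_order_in_space[OF r] in blast)+
  have le_iff: "sel_le \<sigma> x y \<longleftrightarrow> (x, y) \<in> r" if "x \<in> topspace X" "y \<in> topspace X" for x y
  proof
    assume le: "sel_le \<sigma> x y"
    show "(x, y) \<in> r"
    proof (rule ccontr)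
      assume "(x, y) \<notin> r"
      with that total have "(y, x) \<in> r" by blast
      then have "\<sigma> {x, y} = y"
        using min_pair[of y x] by (simp add: insert_commute)
      with le have "x = y" by (simp add: sel_le_def)
      with \<open>(x, y) \<notin> r\<close> that refl show False by blast
    qed
  qed (simp add: sel_le_def min_pair)
  have "weak_selection (topspace X) \<sigma>"
    unfolding weak_selection_def
  proof
    fix S assume S: "S \<in> F2 (topspace X)"
    then have "card S = 1 \<or> card S = 2" by (auto simp: F2_def)
    then obtain x y where xy: "S = {x, y}"
      by (metis card_1_singletonE card_2_iff insert_absorb2)
    then have "x \<in> topspace X" "y \<in> topspace X"
      using S by (auto simp: F2_def)
    then show "\<sigma> S \<in> S"
      using total[of x y] min_pair[of x y] min_pair[of y x] xy by (auto simp: insert_commute)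
  qed
  moreover have "\<forall>U. openin (selection_topology (topspace X) \<sigma>) U \<longrightarrow> openin X U"
    unfolding selection_topology_def open_ray_topology_coarser_iff
  proof
    fix x assume x: "x \<in> topspace X"
    have "{y \<in> topspace X. sel_less \<sigma> y x} = {y \<in> topspace X. (y, x) \<in> r \<and> y \<noteq> x}"
      "{y \<in> topspace X. sel_less \<sigma> x y} = {y \<in> topspace X. (x, y) \<in> r \<and> x \<noteq> y}"
      using x le_iff by (auto simp: sel_less_def)
    then show "openin X {y \<in> topspace X. sel_less \<sigma> y x} \<and>
        openin X {y \<in> topspace X. sel_less \<sigma> x y}"
      using open_rays_order_openin_below[OF r x] open_rays_order_openin_above[OF r x] by simp
  qed
  ultimately have "separately_continuous_selection X \<sigma>"
    by (simp add: separately_continuous_selection_def)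
  with qk obtain q where q: "quasi_king_point (topspace X) \<sigma> q"
    by (auto simp: quasi_king_space_def)
  then have qX: "q \<in> topspace X" by (simp add: quasi_king_point_def)
  have chain: "(x, q) \<in> r"
    if "x \<in> topspace X" "set ys \<subseteq> topspace X" "successively (sel_le \<sigma>) (x # ys @ [q])" for x ys
    using that
  proof (induction ys arbitrary: x)
    case Nil
    then show ?case using le_iff qX by simp
  next
    case (Cons y ys)
    then have "(x, y) \<in> r" "(y, q) \<in> r" using le_iff by auto
    then show ?case by (rule trans)
  qed
  have "(x, q) \<in> r" if "x \<in> topspace X" for x
    using q that chain unfolding quasi_king_point_def by blast
  with qX show ?thesis by blast
qed

definition move_last :: "'a set \<Rightarrow> 'a rel \<Rightarrow> 'a set \<Rightarrow> 'a rel" where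
  "move_last A r Z = {(x, y). x \<in> A \<and> y \<in> A \<and> (x \<notin> Z \<and> y \<in> Z \<or> (x \<in> Z \<longleftrightarrow> y \<in> Z) \<and> (x, y) \<in> r)}"

text \<open>
  Inside the block (\<open>Z\<close> or its complement) that contains the point, a ray of the new order is
  a ray of the old one; of the other block it contains everything or nothing. Clopenness of \<open>Z\<close>
  makes both parts open.
\<close>

lemma open_rays_order_move_last:
  assumes r: "open_rays_order X r" and Z: "openin X Z" "closedin X Z"
  shows "open_rays_order X (move_last (topspace X) r Z)"
proof -
  let ?s = "move_last (topspace X) r Z"
  note refl = open_rays_order_refl[OF r] and total = open_rays_order_total[OF r]
    and antisym = open_rays_order_antisym[OF r] and trans = open_rays_order_trans[OF r]
  have lin: "linear_order_on (topspace X) ?s"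
    unfolding linear_order_on_def partial_order_on_def preorder_on_def
  proof (intro conjI)
    show "refl_on (topspace X) ?s"
      using refl by (auto simp: refl_on_def move_last_def)
    show "trans ?s"
      unfolding trans_def move_last_def using trans by blast
    show "antisym ?s"
      unfolding antisym_def move_last_def using antisym by blast
    show "total_on (topspace X) ?s"
      unfolding total_on_def move_last_def using total by blast
  qed (auto simp: move_last_def)
  have ZX: "Z \<subseteq> topspace X" and Zc: "openin X (topspace X - Z)"
    using Z openin_subset by (auto simp: closedin_def)
  have "openin X {y \<in> topspace X. (y, x) \<in> ?s \<and> y \<noteq> x} \<and>
        openin X {y \<in> topspace X. (x, y) \<in> ?s \<and> x \<noteq> y}" if x: "x \<in> topspace X" for x
  proof -
    let ?b = "{y \<in> topspace X. (y, x) \<in> r \<and> y \<noteq> x}"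
    let ?a = "{y \<in> topspace X. (x, y) \<in> r \<and> x \<noteq> y}"
    note b = open_rays_order_openin_below[OF r x] and a = open_rays_order_openin_above[OF r x]
    show ?thesis
    proof (cases "x \<in> Z")
      case True
      then have "{y \<in> topspace X. (y, x) \<in> ?s \<and> y \<noteq> x} = (topspace X - Z) \<union> (Z \<inter> ?b)"
        and "{y \<in> topspace X. (x, y) \<in> ?s \<and> x \<noteq> y} = Z \<inter> ?a"
        using x ZX by (auto simp: move_last_def)
      then show ?thesis using a b Z(1) Zc by (simp add: openin_Un openin_Int)
    next
      case False
      then have "{y \<in> topspace X. (y, x) \<in> ?s \<and> y \<noteq> x} = (topspace X - Z) \<inter> ?b"
        and "{y \<in> topspace X. (x, y) \<in> ?s \<and> x \<noteq> y} = Z \<union> ((topspace X - Z) \<inter> ?a)"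
        using x ZX by (auto simp: move_last_def)
      then show ?thesis using a b Z(1) Zc by (simp add: openin_Un openin_Int)
    qed
  qed
  with lin show ?thesis by (simp add: open_rays_order_def)
qed

lemma clopen_has_greatest:
  assumes "quasi_king_space X" "open_rays_order X r"
    and Z: "openin X Z" "closedin X Z" "Z \<noteq> {}"
  shows "\<exists>q\<in>Z. \<forall>x\<in>Z. (x, q) \<in> r"
proof -
  obtain q where q: "\<forall>x\<in>topspace X. (x, q) \<in> move_last (topspace X) r Z"
    using quasi_king_space_has_greatest[OF assms(1) open_rays_order_move_last[OF assms(2) Z(1,2)]]
    by blast
  have "Z \<subseteq> topspace X" using Z(1) by (rule openin_subset)
  then show ?thesis
    using q Z(3) unfolding move_last_def by blast
qed

lemma clopen_has_least:
  assumes "quasi_king_space X" "open_rays_order X r"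
    and "openin X Z" "closedin X Z" "Z \<noteq> {}"
  shows "\<exists>q\<in>Z. \<forall>x\<in>Z. (q, x) \<in> r"
  using clopen_has_greatest[OF assms(1) open_rays_order_converse[OF assms(2)] assms(3-)] by simp

section \<open>Finite subcovers\<close>

text \<open>
  If the complement \<open>B\<close> of \<open>A\<close> were nonempty, one of three clopen sets would give a contradiction
  by its end points. If \<open>B\<close> has a least point, it is the part of the ray up to that point that lies
  outside a member of the cover through it; if not, but \<open>A\<close> has a greatest point, it is what a
  family covering everything up to this point misses; and if neither exists, it is \<open>B\<close> itself.
\<close>

lemma clopen_cover_finite_subcover:
  assumes r: "open_rays_order X r"
    and greatest: "\<And>Z. openin X Z \<Longrightarrow> closedin X Z \<Longrightarrow> Z \<noteq> {} \<Longrightarrow> \<exists>q\<in>Z. \<forall>x\<in>Z. (x, q) \<in> r"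
    and least: "\<And>Z. openin X Z \<Longrightarrow> closedin X Z \<Longrightarrow> Z \<noteq> {} \<Longrightarrow> \<exists>q\<in>Z. \<forall>x\<in>Z. (q, x) \<in> r"
    and clopen: "\<And>U. U \<in> \<U> \<Longrightarrow> openin X U \<and> closedin X U"
    and cover: "\<Union>\<U> = topspace X"
  shows "\<exists>\<F>. finite \<F> \<and> \<F> \<subseteq> \<U> \<and> \<Union>\<F> = topspace X"
proof (cases "topspace X = {}")
  case True
  then show ?thesis by (intro exI[of _ "{}"]) auto
next
  case False
  note refl = open_rays_order_refl[OF r] and total = open_rays_order_total[OF r]
    and antisym = open_rays_order_antisym[OF r] and trans = open_rays_order_trans[OF r]
  define A where
    "A = {x \<in> topspace X. \<exists>\<F>. finite \<F> \<and> \<F> \<subseteq> \<U> \<and> {y \<in> topspace X. (y, x) \<in> r} \<subseteq> \<Union>\<F>}"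
  define B where "B = topspace X - A"
  have A_down: "x \<in> A" if "(x, y) \<in> r" "y \<in> A" for x y
  proof -
    have "x \<in> topspace X" "{z \<in> topspace X. (z, x) \<in> r} \<subseteq> {z \<in> topspace X. (z, y) \<in> r}"
      using open_rays_order_in_space[OF r that(1)] trans[OF _ that(1)] by blast+
    with that(2) show ?thesis unfolding A_def by blast
  qed
  have A_I: "x \<in> A" if "x \<in> topspace X" "U \<in> \<U>" "finite \<F>" "\<F> \<subseteq> \<U>"
    "\<And>y. y \<in> topspace X \<Longrightarrow> (y, x) \<in> r \<Longrightarrow> y \<notin> U \<Longrightarrow> y \<in> \<Union>\<F>" for x U \<F>
    unfolding A_def using that by (auto intro!: exI[of _ "insert U \<F>"])
  have "B = {}"
  proof (rule ccontr)
    assume "B \<noteq> {}"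
    show False
    proof (cases "\<exists>b\<in>B. \<forall>x\<in>B. (b, x) \<in> r")
      case True
      then obtain b where b: "b \<in> B" "\<And>x. x \<in> B \<Longrightarrow> (b, x) \<in> r" by blast
      then have bX: "b \<in> topspace X" by (simp add: B_def)
      then obtain U where U: "U \<in> \<U>" "b \<in> U" using cover by blast
      \<comment> \<open>As \<open>U\<close> contains \<open>b\<close>, removing \<open>U\<close> from the closed ray or from the open ray
         below \<open>b\<close> gives the same set, which is therefore clopen.\<close>
      define C where "C = {y \<in> topspace X. (y, b) \<in> r} - U"
      have "C = {y \<in> topspace X. (y, b) \<in> r \<and> y \<noteq> b} - U"
        using U(2) by (auto simp: C_def)
      then have "openin X C"
        using open_rays_order_openin_below[OF r bX] clopen[OF U(1)] by (simp add: openin_diff)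
      moreover have "closedin X C"
        unfolding C_def
        using open_rays_order_closedin_atMost[OF r bX] clopen[OF U(1)] by (simp add: closedin_diff)
      ultimately have C: "C = {} \<or> (\<exists>c\<in>C. \<forall>x\<in>C. (x, c) \<in> r)" using greatest by blast
      have "b \<in> A"
      proof (cases "C = {}")
        case True
        then show ?thesis
          by (intro A_I[OF bX U(1), of "{}"]) (auto simp: C_def)
      next
        case False
        with C obtain c where c: "c \<in> C" "\<And>x. x \<in> C \<Longrightarrow> (x, c) \<in> r" by blast
        have "c \<in> topspace X" "(c, b) \<in> r" "c \<noteq> b" using c(1) U(2) by (auto simp: C_def)
        then have "c \<in> A" using b(2)[of c] antisym by (auto simp: B_def)
        then obtain \<F> where F: "finite \<F>" "\<F> \<subseteq> \<U>" "{y \<in> topspace X. (y, c) \<in> r} \<subseteq> \<Union>\<F>"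
          by (auto simp: A_def)
        show ?thesis
          using c(2) F(3) by (intro A_I[OF bX U(1) F(1,2)]) (auto simp: C_def)
      qed
      with b(1) show False by (simp add: B_def)
    next
      case B_no_least: False
      show False
      proof (cases "\<exists>a\<in>A. \<forall>x\<in>A. (x, a) \<in> r")
        case True
        then obtain a where a: "a \<in> A" "\<And>x. x \<in> A \<Longrightarrow> (x, a) \<in> r" by blast
        then obtain \<F> where F: "finite \<F>" "\<F> \<subseteq> \<U>" "{y \<in> topspace X. (y, a) \<in> r} \<subseteq> \<Union>\<F>"
          by (auto simp: A_def)
        have F_clopen: "openin X (\<Union>\<F>)" "closedin X (\<Union>\<F>)"
          using F(1,2) clopen by (blast intro: openin_Union closedin_Union)+
        \<comment> \<open>The first point that the family covering everything up to \<open>a\<close> misses lies in \<open>A\<close>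
           all the same, although it comes after the last point of \<open>A\<close>.\<close>
        define R where "R = topspace X - \<Union>\<F>"
        have "R \<noteq> {}"
        proof
          assume "R = {}"
          obtain x where x: "x \<in> B" using \<open>B \<noteq> {}\<close> by blast
          then have "x \<in> A"
            using F \<open>R = {}\<close> by (auto simp: A_def B_def R_def intro!: exI[of _ \<F>])
          with x show False by (simp add: B_def)
        qed
        moreover have "openin X R" "closedin X R"
          using F_clopen by (auto simp: R_def)
        ultimately have "\<exists>c\<in>R. \<forall>x\<in>R. (c, x) \<in> r"
          by (intro least)
        then obtain c where c: "c \<in> R" "\<And>x. x \<in> R \<Longrightarrow> (c, x) \<in> r" by blast
        have cX: "c \<in> topspace X" using c(1) by (simp add: R_def)
        then obtain U where U: "U \<in> \<U>" "c \<in> U" using cover by blast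
        have "c \<in> A"
        proof (rule A_I[OF cX U(1) F(1,2)], rule ccontr)
          fix y assume y: "y \<in> topspace X" "(y, c) \<in> r" "y \<notin> U" "y \<notin> \<Union>\<F>"
          then have "(c, y) \<in> r" using c(2)[of y] by (simp add: R_def)
          with y(2) have "y = c" by (rule antisym)
          with y(3) U(2) show False by simp
        qed
        with a(2) have "(c, a) \<in> r" by blast
        with F(3) cX c(1) show False by (auto simp: R_def)
      next
        case A_no_greatest: False
        \<comment> \<open>Now both sides of the cut are unions of open rays, so the cut is clopen.\<close>
        have AX: "A \<subseteq> topspace X" by (auto simp: A_def)
        have "openin X A"
        proof (subst openin_subopen, intro ballI)
          fix x assume x: "x \<in> A"
          with A_no_greatest obtain a where a: "a \<in> A" "(a, x) \<notin> r" by blast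
          have xX: "x \<in> topspace X" and aX: "a \<in> topspace X" using x a(1) AX by blast+
          have "(x, a) \<in> r" "x \<noteq> a" using total[OF xX aX] refl[OF xX] a(2) by blast+
          with xX a(1) A_down
          show "\<exists>T. openin X T \<and> x \<in> T \<and> T \<subseteq> A"
            by (intro exI[of _ "{y \<in> topspace X. (y, a) \<in> r \<and> y \<noteq> a}"])
              (use open_rays_order_openin_below[OF r aX] in blast)
        qed
        moreover have "openin X B"
        proof (subst openin_subopen, intro ballI)
          fix x assume x: "x \<in> B"
          with B_no_least obtain b where b: "b \<in> B" "(x, b) \<notin> r" by blast
          have xX: "x \<in> topspace X" and bX: "b \<in> topspace X" using x b(1) by (auto simp: B_def)
          have "(b, x) \<in> r" "b \<noteq> x" using total[OF xX bX] refl[OF xX] b(2) by blast+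
          with x b(1) A_down
          show "\<exists>T. openin X T \<and> x \<in> T \<and> T \<subseteq> B"
            by (intro exI[of _ "{y \<in> topspace X. (b, y) \<in> r \<and> b \<noteq> y}"])
              (use open_rays_order_openin_above[OF r bX] in \<open>auto simp: B_def\<close>)
        qed
        ultimately have "openin X B" "closedin X B"
          using AX by (auto simp: B_def)
        with \<open>B \<noteq> {}\<close> have "\<exists>b\<in>B. \<forall>x\<in>B. (b, x) \<in> r"
          by (intro least)
        with B_no_least show False by blast
      qed
    qed
  qed
  \<comment> \<open>It remains to look at the greatest point of the whole space.\<close>
  obtain m where m: "m \<in> topspace X" "\<forall>x\<in>topspace X. (x, m) \<in> r"
    using greatest[OF openin_topspace closedin_topspace False] by blast
  with \<open>B = {}\<close> have "m \<in> A" by (auto simp: B_def)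
  then obtain \<F> where F: "finite \<F>" "\<F> \<subseteq> \<U>" "{y \<in> topspace X. (y, m) \<in> r} \<subseteq> \<Union>\<F>"
    by (auto simp: A_def)
  with m(2) have "topspace X \<subseteq> \<Union>\<F>" by blast
  with F(1,2) cover show ?thesis by blast
qed

theorem theorem4p1:
  fixes X :: "'a topology" and \<U> :: "'a set set"
  assumes "Hausdorff_space X"
    and "weakly_orderable X"
    and "quasi_king_space X"
    and "\<And>U. U \<in> \<U> \<Longrightarrow> openin X U \<and> closedin X U"
    and "\<Union>\<U> = topspace X"
  shows "\<exists>\<F>. finite \<F> \<and> \<F> \<subseteq> \<U> \<and> \<Union>\<F> = topspace X"
proof -
  obtain r where r: "open_rays_order X r"
    using assms(2) by (auto simp: weakly_orderable_iff_open_rays_order)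
  show ?thesis
    by (rule clopen_cover_finite_subcover[OF r clopen_has_greatest[OF assms(3) r]
          clopen_has_least[OF assms(3) r] assms(4,5)])
qed

end
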